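(* Let $G=(V,A)$ be a heating network, and let $C\subseteq A^S$ or $C\subseteq A^R$ be a cycle, i.e., $C$ forms a cycle in the underlying undirected graph. Fix an arbitrary traversal direction of $C$, and let $C^+$ and $C^-$ be the subsets of arcs of $C$ that are traversed in forward and backward direction, respectively. Then in every feasible solution of the stationary heating network model there cannot exist a nonzero flow along $C$; that is, it is neither the case that $\dot m_a>0$ for all $a\in C^+$ and $\dot m_a<0$ for all $a\in C^-$, nor that $\dot m_a<0$ for all $a\in C^+$ and $\dot m_a>0$ for all $a\in C^-$.
   Context: **Heating network.** A heating network is a weakly connected, simple directed graph $G=(V,A)$ (no self-loops, no parallel or antiparallel arcs) with $V=V^S\,\dot\cup\,V^R$ (supply and return nodes) and $A=A^S\,\dot\cup\,A^R\,\dot\cup\,A^H\,\dot\cup\,A^D$, where $A^S\subset V^S\times V^S$ (supply pipes), $A^R\subset V^R\times V^R$ (return pipes), $A^H\subset V^R\times V^S$ (heating arcs), $A^D\subset V^S\times V^R$ (demand arcs). Put $A^P=A^S\cup A^R$ (pipe arcs). Every node is incident to a heating arc or a demand arc. For $v\in V$, $\delta^+(v)$ and $\delta^-(v)$ are the sets of arcs leaving and entering $v$. **Parameters.** For $a\in A^P$: $\zeta_a=\lambda_a\frac{\ell_a}{d_a^5}\frac{8}{\pi^2\rho}>0$ (with positive friction coefficient $\lambda_a$, length $\ell_a$, diameter $d_a$, and water density $\rho$), heat loss coefficient $\mu_a$, maximal mass flow $\overline m_a$. Further: gravitational constant $g$, node heights $h_v$ ($v\in V$), specific heat capacity $c_p>0$,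 ambient temperature $\tau$, pump efficiencies $\eta_a\in[0,1]$, bounds $\overline T_a$ and $\underline{\dot Q}_a$ for $a\in A^H$, demands $\dot Q^D_a$ for $a\in A^D$, minimal pressure drop $\underline{\Delta p}>0$, fixed consumer outlet temperature $\underline T$, and a node $\bar v$ with fixed pressure $\overline p$. **Feasible solution.** A feasible solution of the stationary heating network model consists of real values $\dot m_a$ ($a\in A$; mass flow, positive along the arc direction), $p_v,T_v$ ($v\in V$), $T^-_a$ ($a\in A$), $T^+_a$ ($a\in A^P$), $P_a,\dot Q_a$ ($a\in A^H$), and $b^+_a,b^-_a\in\{0,1\}$ ($a\in A^P$), where $b^+_a=1$, $b^-_a=0$ for $a\in A^H\cup A^D$, satisfying: - $\sum_{a\in\delta^+(v)}\dot m_a-\sum_{a\in\delta^-(v)}\dot m_a=0$ for all $v\in V$; - temperature mixing, for all $v\in V$: $T_v\big(\sum_{a\in\delta^-(v)}b^+_a\dot m_a-\sum_{a\in\delta^+(v)}b^-_a\dot m_a\big)=\sum_{a\in\delta^-(v)}b^+_a\dot m_aT^-_a-\sum_{a\in\delta^+(v)}b^-_a\dot m_aT^-_a$; - $p_u-p_v=\zeta_a\dot m_a|\dot m_a|-\rho g(h_u-h_v)$ for $a=(u,v)\in A^P$; - $p_u-p_v\ge\underline{\Delta p}$ for $a=(u,v)\in A^D$; - $P_a=\frac{1}{\eta_a\rho}(p_v-p_u)\dot m_a$ and $\dot Q_a=c_p\dot m_a(T_u-T^-_a)$ for $a=(u,v)\in A^H$; - $|\dot m_a|T^-_a=|\dot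 m_a|T^+_a-\frac{\mu_a\ell_a}{c_p}(T^+_a-\tau)$ and $T^+_a=T_ub^+_a+T_vb^-_a$ for $a=(u,v)\in A^P$; - $c_p\dot m_a(T_u-\underline T)=\dot Q^D_a$ and $T^-_a=\underline T$ for $a=(u,v)\in A^D$; - $b^+_a+b^-_a=1$ and $-\overline m_ab^-_a\le\dot m_a\le\overline m_ab^+_a$ for $a\in A^P$; - $p_{\bar v}=\overline p$; $T_v\ge\tau$ for $v\in V$; $T^-_a\ge\tau$ for $a\in A^P$; - $T^-_a\le\overline T_a$, $P_a\ge0$, $\underline{\dot Q}_a\le\dot Q_a\le0$ for $a\in A^H$; $\dot m_a\ge0$ for $a\in A^D\cup A^H$. *)

theory Defs
  imports Complex_Main "Graph_Theory.Graph_Theory"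
begin

text \<open>
  Arcs are pairs of nodes, so parallel arcs are excluded by construction. Arc- and node-indexed
  data are total functions; values outside the index set stated in the model are unconstrained.
\<close>

record 'v heating_data =
  net :: "'v pair_pre_digraph"
  V_S :: "'v set"                       \<comment> \<open>supply nodes\<close>
  V_R :: "'v set"                       \<comment> \<open>return nodes\<close>
  A_S :: "('v \<times> 'v) set"                \<comment> \<open>supply pipes\<close>
  A_R :: "('v \<times> 'v) set"                \<comment> \<open>return pipes\<close>
  A_H :: "('v \<times> 'v) set"                \<comment> \<open>heating arcs\<close>
  A_D :: "('v \<times> 'v) set"                \<comment> \<open>demand arcs\<close>
  friction :: "'v \<times> 'v \<Rightarrow> real"         \<comment> \<open>friction coefficient $\lambda_a$\<close>
  pipe_length :: "'v \<times> 'v \<Rightarrow> real"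
  diameter :: "'v \<times> 'v \<Rightarrow> real"
  heat_loss :: "'v \<times> 'v \<Rightarrow> real"        \<comment> \<open>$\mu_a$\<close>
  m_max :: "'v \<times> 'v \<Rightarrow> real"            \<comment> \<open>maximal mass flow in pipes\<close>
  height :: "'v \<Rightarrow> real"
  rho :: real                            \<comment> \<open>water density\<close>
  grav :: real                           \<comment> \<open>gravitational constant\<close>
  c_p :: real                            \<comment> \<open>specific heat capacity\<close>
  tau :: real                            \<comment> \<open>ambient temperature\<close>
  pump_eff :: "'v \<times> 'v \<Rightarrow> real"         \<comment> \<open>pump efficiency $\eta_a$\<close>
  T_max :: "'v \<times> 'v \<Rightarrow> real"            \<comment> \<open>bound on the outlet temperature of heating arcs\<close>
  Q_min :: "'v \<times> 'v \<Rightarrow> real"            \<comment> \<open>lower bound on the heat flow of heating arcs\<close>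
  Q_dem :: "'v \<times> 'v \<Rightarrow> real"            \<comment> \<open>demand $\dot Q^D_a$\<close>
  dp_min :: real                         \<comment> \<open>minimal pressure drop over demand arcs\<close>
  T_cons :: real                         \<comment> \<open>consumer outlet temperature\<close>
  v_ref :: 'v                            \<comment> \<open>node of fixed pressure\<close>
  p_ref :: real

definition nodes :: "'v heating_data \<Rightarrow> 'v set" where
  "nodes N = pverts (net N)"

definition all_arcs :: "'v heating_data \<Rightarrow> ('v \<times> 'v) set" where
  "all_arcs N = parcs (net N)"

definition A_P :: "'v heating_data \<Rightarrow> ('v \<times> 'v) set" where
  "A_P N = A_S N \<union> A_R N"

definition zeta :: "'v heating_data \<Rightarrow> 'v \<times> 'v \<Rightarrow> real" where
  "zeta N a = friction N a * (pipe_length N a / diameter N a ^ 5) * (8 / (pi\<^sup>2 * rho N))"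

abbreviation \<delta>_out :: "'v heating_data \<Rightarrow> 'v \<Rightarrow> ('v \<times> 'v) set" where
  "\<delta>_out N \<equiv> out_arcs (with_proj (net N))"

abbreviation \<delta>_in :: "'v heating_data \<Rightarrow> 'v \<Rightarrow> ('v \<times> 'v) set" where
  "\<delta>_in N \<equiv> in_arcs (with_proj (net N))"

text \<open>\<^const>\<open>pair_digraph\<close> provides finiteness, well-formedness and the absence of loops;
  \<^const>\<open>Digraph_Component.connected\<close> is weak connectivity.\<close>

locale heating_network =
  fixes N :: "'v heating_data"
  assumes digraph: "pair_digraph (net N)"
    and no_antiparallel: "(u, v) \<in> all_arcs N \<Longrightarrow> (v, u) \<notin> all_arcs N"
    and weakly_connected: "Digraph_Component.connected (with_proj (net N))"
    and V_partition: "nodes N = V_S N \<union> V_R N" "V_S N \<inter> V_R N = {}"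
    and A_partition: "all_arcs N = A_S N \<union> A_R N \<union> A_H N \<union> A_D N"
    and A_S_subset: "A_S N \<subseteq> V_S N \<times> V_S N"
    and A_R_subset: "A_R N \<subseteq> V_R N \<times> V_R N"
    and A_H_subset: "A_H N \<subseteq> V_R N \<times> V_S N"
    and A_D_subset: "A_D N \<subseteq> V_S N \<times> V_R N"
    and incident: "v \<in> nodes N \<Longrightarrow> \<exists>a \<in> A_H N \<union> A_D N. v = fst a \<or> v = snd a"
    and friction_pos: "a \<in> A_P N \<Longrightarrow> friction N a > 0"
    and pipe_length_pos: "a \<in> A_P N \<Longrightarrow> pipe_length N a > 0"
    and diameter_pos: "a \<in> A_P N \<Longrightarrow> diameter N a > 0"
    and rho_pos: "rho N > 0"
    and c_p_pos: "c_p N > 0"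
    and pump_eff_range: "a \<in> A_H N \<Longrightarrow> 0 \<le> pump_eff N a \<and> pump_eff N a \<le> 1"
    and dp_min_pos: "dp_min N > 0"
    and v_ref_in_V: "v_ref N \<in> nodes N"
begin

text \<open>Disjointness of the four arc classes is a consequence of the disjointness of
  supply and return nodes.\<close>

lemma arc_classes_disjoint:
  "A_S N \<inter> A_R N = {}" "A_S N \<inter> A_H N = {}" "A_S N \<inter> A_D N = {}"
  "A_R N \<inter> A_H N = {}" "A_R N \<inter> A_D N = {}" "A_H N \<inter> A_D N = {}"
  using V_partition(2) A_S_subset A_R_subset A_H_subset A_D_subset by blast+

lemma zeta_pos: "a \<in> A_P N \<Longrightarrow> zeta N a > 0"
  using friction_pos pipe_length_pos diameter_pos rho_pos by (simp add: zeta_def)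

end

record 'v heating_state =
  flow :: "'v \<times> 'v \<Rightarrow> real"        \<comment> \<open>mass flow\<close>
  press :: "'v \<Rightarrow> real"              \<comment> \<open>pressure\<close>
  temp :: "'v \<Rightarrow> real"              \<comment> \<open>node temperature\<close>
  T_minus :: "'v \<times> 'v \<Rightarrow> real"
  T_plus :: "'v \<times> 'v \<Rightarrow> real"
  pump :: "'v \<times> 'v \<Rightarrow> real"        \<comment> \<open>pump power\<close>
  heat :: "'v \<times> 'v \<Rightarrow> real"        \<comment> \<open>heat flow\<close>
  b_plus :: "'v \<times> 'v \<Rightarrow> real"
  b_minus :: "'v \<times> 'v \<Rightarrow> real"

text \<open>If \<open>pump_eff N (u, v) = 0\<close>, the fraction in \<open>pump_power\<close> is \<open>0\<close> by the
  convention for division by zero.\<close>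

locale feasible_solution =
  fixes N :: "'v heating_data" and X :: "'v heating_state"
  assumes b_pipe: "a \<in> A_P N \<Longrightarrow> b_plus X a \<in> {0, 1} \<and> b_minus X a \<in> {0, 1}"
    and b_nonpipe: "a \<in> A_H N \<union> A_D N \<Longrightarrow> b_plus X a = 1 \<and> b_minus X a = 0"
    and mass_conservation:
      "v \<in> nodes N \<Longrightarrow> (\<Sum>a\<in>\<delta>_out N v. flow X a) - (\<Sum>a\<in>\<delta>_in N v. flow X a) = 0"
    and temperature_mixing:
      "v \<in> nodes N \<Longrightarrow>
        temp X v * ((\<Sum>a\<in>\<delta>_in N v. b_plus X a * flow X a) - (\<Sum>a\<in>\<delta>_out N v. b_minus X a * flow X a))
        = (\<Sum>a\<in>\<delta>_in N v. b_plus X a * flow X a * T_minus X a)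
          - (\<Sum>a\<in>\<delta>_out N v. b_minus X a * flow X a * T_minus X a)"
    and pipe_pressure:
      "(u, v) \<in> A_P N \<Longrightarrow>
        press X u - press X v
        = zeta N (u, v) * flow X (u, v) * \<bar>flow X (u, v)\<bar> - rho N * grav N * (height N u - height N v)"
    and demand_pressure: "(u, v) \<in> A_D N \<Longrightarrow> press X u - press X v \<ge> dp_min N"
    and pump_power:
      "(u, v) \<in> A_H N \<Longrightarrow>
        pump X (u, v) = 1 / (pump_eff N (u, v) * rho N) * (press X v - press X u) * flow X (u, v)"
    and heating:
      "(u, v) \<in> A_H N \<Longrightarrow> heat X (u, v) = c_p N * flow X (u, v) * (temp X u - T_minus X (u, v))"
    and pipe_heat_loss:
      "a \<in> A_P N \<Longrightarrow>
        \<bar>flow X a\<bar> * T_minus X a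
        = \<bar>flow X a\<bar> * T_plus X a - heat_loss N a * pipe_length N a / c_p N * (T_plus X a - tau N)"
    and pipe_inflow_temperature:
      "(u, v) \<in> A_P N \<Longrightarrow>
        T_plus X (u, v) = temp X u * b_plus X (u, v) + temp X v * b_minus X (u, v)"
    and demand_heat:
      "(u, v) \<in> A_D N \<Longrightarrow> c_p N * flow X (u, v) * (temp X u - T_cons N) = Q_dem N (u, v)"
    and demand_outlet: "a \<in> A_D N \<Longrightarrow> T_minus X a = T_cons N"
    and one_direction: "a \<in> A_P N \<Longrightarrow> b_plus X a + b_minus X a = 1"
    and flow_bounds:
      "a \<in> A_P N \<Longrightarrow> - m_max N a * b_minus X a \<le> flow X a \<and> flow X a \<le> m_max N a * b_plus X a"
    and reference_pressure: "press X (v_ref N) = p_ref N"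
    and node_temperature: "v \<in> nodes N \<Longrightarrow> temp X v \<ge> tau N"
    and pipe_temperature: "a \<in> A_P N \<Longrightarrow> T_minus X a \<ge> tau N"
    and heating_temperature: "a \<in> A_H N \<Longrightarrow> T_minus X a \<le> T_max N a"
    and pump_nonneg: "a \<in> A_H N \<Longrightarrow> pump X a \<ge> 0"
    and heating_bounds: "a \<in> A_H N \<Longrightarrow> Q_min N a \<le> heat X a \<and> heat X a \<le> 0"
    and nonpipe_flow: "a \<in> A_D N \<union> A_H N \<Longrightarrow> flow X a \<ge> 0"

text \<open>
  A cycle of the underlying undirected graph together with a traversal direction is a directed
  cycle \<open>c\<close> of the symmetric closure; an arc is traversed forward if it lies on \<open>c\<close> and backward
  if its reversal does. The bound on the length excludes going back and forth along a single arc,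
  which is a directed cycle of the symmetric closure but not an undirected cycle.
\<close>

definition forward_arcs :: "('v \<times> 'v) set \<Rightarrow> ('v \<times> 'v) list \<Rightarrow> ('v \<times> 'v) set" where
  "forward_arcs C c = {a \<in> C. a \<in> set c}"

definition backward_arcs :: "('v \<times> 'v) set \<Rightarrow> ('v \<times> 'v) list \<Rightarrow> ('v \<times> 'v) set" where
  "backward_arcs C c = {a \<in> C. prod.swap a \<in> set c}"

definition traverses_cycle ::
  "'v pair_pre_digraph \<Rightarrow> ('v \<times> 'v) set \<Rightarrow> ('v \<times> 'v) list \<Rightarrow> bool" where
  "traverses_cycle G C c \<longleftrightarrow>
    pre_digraph.cycle (with_proj (mk_symmetric (with_proj G))) c \<and> length c \<ge> 3 \<and>
    C = {a \<in> parcs G. a \<in> set c \<or> prod.swap a \<in> set c}"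

end

theory Submission
  imports Defs
begin

text \<open>
  The pressure equation makes the flow on a pipe \<open>(u, v)\<close> have the sign of \<open>\<Phi> u - \<Phi> v\<close>, where
  \<open>\<Phi> v = p\<^sub>v + \<rho> g h\<^sub>v\<close>. A nonzero flow along the cycle would therefore make \<open>\<Phi>\<close> strictly monotone
  along a closed walk.
\<close>

text \<open>In a walk the head of each arc is the tail of the next, so the sum telescopes; on a
  closed walk it vanishes.\<close>

lemma (in pre_digraph) sum_list_cas:
  fixes f :: "'a \<Rightarrow> 'c::ab_group_add"
  shows "cas u p v \<Longrightarrow> (\<Sum>e\<leftarrow>p. f (tail G e) - f (head G e)) = f u - f v"
  by (induction u p v rule: cas.induct) auto

text \<open>If \<open>f\<close> dropped strictly along every arc, the telescoping sum would be
  positive, yet it is 0 because the walk is closed.\<close>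

lemma (in pre_digraph) cycle_not_strictly_decreasing:
  fixes f :: "'a \<Rightarrow> 'c::linordered_ab_group_add"
  assumes "cycle p"
  shows "\<exists>e\<in>set p. f (tail G e) \<le> f (head G e)"
proof (rule ccontr)
  assume "\<not> ?thesis"
  then have pos: "\<And>e. e \<in> set p \<Longrightarrow> 0 < f (tail G e) - f (head G e)"
    by auto
  obtain u where "cas u p u" "p \<noteq> []"
    using assms by (auto simp: cycle_def awalk_def)
  then have "(\<Sum>e\<leftarrow>p. f (tail G e) - f (head G e)) = 0"
    by (simp add: sum_list_cas)
  moreover have "0 < (\<Sum>e\<leftarrow>p. f (tail G e) - f (head G e))"
    using \<open>p \<noteq> []\<close> pos
  \<comment> \<open>The base case is a single arc, since the empty sum is 0 and not
    positive.\<close>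
  proof (induction p rule: list_nonempty_induct)
    case (cons e p)
    then show ?case by (auto intro: add_pos_pos)
  qed auto
  ultimately show False by simp
qed

text \<open>This is the hydraulic head in units of pressure. It absorbs the gravity term of the
  pressure equation, so only the friction term is left.\<close>

definition potential :: "'v heating_data \<Rightarrow> 'v heating_state \<Rightarrow> 'v \<Rightarrow> real" where
  "potential N X v = press X v + rho N * grav N * height N v"

text \<open>The friction term is \<open>zeta\<close> times \<open>m * \<bar>m\<bar>\<close> for the
  flow \<open>m\<close>; \<open>zeta\<close> is positive on pipes, and
  \<open>m * \<bar>m\<bar>\<close> has the sign of \<open>m\<close>.\<close>

lemma sgn_potential_diff:
  assumes "heating_network N" "feasible_solution N X" "(u, v) \<in> A_P N"
  shows "sgn (potential N X u - potential N X v) = sgn (flow X (u, v))"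
proof -
  have "potential N X u - potential N X v = zeta N (u, v) * (flow X (u, v) * \<bar>flow X (u, v)\<bar>)"
    using feasible_solution.pipe_pressure[OF assms(2,3)]
    by (simp add: potential_def algebra_simps)
  then show ?thesis
    using heating_network.zeta_pos[OF assms(1,3)] by (auto simp: sgn_mult sgn_zero_iff)
qed

text \<open>The traversal runs in the symmetric closure, so each of its steps is an arc of
  \<open>G\<close> or the reversal of one.\<close>

lemma traversed_arc_cases:
  assumes "traverses_cycle G C c" "(u, v) \<in> set c"
  obtains "(u, v) \<in> forward_arcs C c" | "(v, u) \<in> backward_arcs C c"
proof -
  have "(u, v) \<in> parcs (mk_symmetric (with_proj G))"
    using assms by (auto simp: traverses_cycle_def pre_digraph.cycle_def pre_digraph.awalk_def)
  then have "(u, v) \<in> parcs G \<or> (v, u) \<in> parcs G"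
    by (auto simp: parcs_mk_symmetric)
  then show thesis
    using that assms by (auto simp: traverses_cycle_def forward_arcs_def backward_arcs_def)
qed

theorem lemma4:
  fixes N :: "'v heating_data"
    and X :: "'v heating_state"
    and C :: "('v \<times> 'v) set"
    and c :: "('v \<times> 'v) list"
  assumes "heating_network N"
    and "C \<subseteq> A_S N \<or> C \<subseteq> A_R N"
    and "traverses_cycle (net N) C c"
    and "feasible_solution N X"
  shows "\<not> ((\<forall>a \<in> forward_arcs C c. flow X a > 0) \<and> (\<forall>a \<in> backward_arcs C c. flow X a < 0)) \<and>
         \<not> ((\<forall>a \<in> forward_arcs C c. flow X a < 0) \<and> (\<forall>a \<in> backward_arcs C c. flow X a > 0))"
proof -
  let ?\<Phi> = "potential N X"
  have C: "C \<subseteq> A_P N"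
    using assms(2) by (auto simp: A_P_def)
  have cycle: "pre_digraph.cycle (with_proj (mk_symmetric (with_proj (net N)))) c"
    using assms(3) by (simp add: traverses_cycle_def)
  have fwd: "sgn (?\<Phi> u - ?\<Phi> v) = sgn (flow X (u, v))" if "(u, v) \<in> forward_arcs C c" for u v
    using sgn_potential_diff[OF assms(1,4)] that C by (auto simp: forward_arcs_def)
  have bwd: "sgn (?\<Phi> v - ?\<Phi> u) = sgn (flow X (v, u))" if "(v, u) \<in> backward_arcs C c" for u v
    using sgn_potential_diff[OF assms(1,4)] that C by (auto simp: backward_arcs_def)
  show ?thesis
  proof (intro conjI notI; elim conjE)
    assume *: "\<forall>a\<in>forward_arcs C c. flow X a > 0" "\<forall>a\<in>backward_arcs C c. flow X a < 0"
    \<comment> \<open>Flow along the traversal would make \<open>?\<Phi>\<close> drop at every step,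
      so a step without a drop is contradictory.\<close>
    obtain u v where uv: "(u, v) \<in> set c" "?\<Phi> u \<le> ?\<Phi> v"
      using pre_digraph.cycle_not_strictly_decreasing[OF cycle, of ?\<Phi>] by auto
    from assms(3) uv(1) show False
    proof (cases rule: traversed_arc_cases)
      case 1
      with fwd[OF 1] * uv(2) show False by (auto simp: sgn_if split: if_splits)
    next
      case 2
      \<comment> \<open>The arc is \<open>(v, u)\<close>: its negative flow gives
        \<open>?\<Phi> v < ?\<Phi> u\<close>.\<close>
      with bwd[OF 2] * uv(2) show False by (auto simp: sgn_if split: if_splits)
    qed
  next
    assume *: "\<forall>a\<in>forward_arcs C c. flow X a < 0" "\<forall>a\<in>backward_arcs C c. flow X a > 0"
    \<comment> \<open>Flow against the traversal makes \<open>?\<Phi>\<close> rise at every step;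
      negating it avoids reversing the cycle.\<close>
    obtain u v where uv: "(u, v) \<in> set c" "?\<Phi> v \<le> ?\<Phi> u"
      using pre_digraph.cycle_not_strictly_decreasing[OF cycle, of "\<lambda>v. - ?\<Phi> v"] by auto
    from assms(3) uv(1) show False
    proof (cases rule: traversed_arc_cases)
      case 1
      with fwd[OF 1] * uv(2) show False by (auto simp: sgn_if split: if_splits)
    next
      case 2
      with bwd[OF 2] * uv(2) show False by (auto simp: sgn_if split: if_splits)
    qed
  qed
qed

end
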